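(* For $n\ge 2$, the number $\kappa_n$ of connected permutations of $\{1,\ldots,n\}$ is $$\kappa_n=\sum_{k=1}^{n-1}\sum_{1= i_1<i_2<\cdots<i_{k+1}=n}\prod_{j=1}^k (i_{j+1}-i_j-1)!\cdot i_j.$$
   Context: A permutation $\pi\in S_n$ is connected (indecomposable) if there is no $m<n$ with $\pi(\{1,\ldots,m\})=\{1,\ldots,m\}$. *)

theory Defs
  imports Complex_Main "HOL-Combinatorics.Permutations" "HOL-Library.FuncSet"
begin

text \<open>The case \<open>m = 0\<close> has to be excluded: every permutation maps the empty set onto itself.\<close>

definition connected_perm :: "nat \<Rightarrow> (nat \<Rightarrow> nat) \<Rightarrow> bool" where
  "connected_perm n \<pi> \<longleftrightarrow>
     \<pi> permutes {1..n} \<and> \<not> (\<exists>m. 1 \<le> m \<and> m < n \<and> \<pi> ` {1..m} = {1..m})"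

definition kappa :: "nat \<Rightarrow> nat" where
  "kappa n = card {\<pi>. connected_perm n \<pi>}"

text \<open>Chains \<open>1 = i 1 < i 2 < \<dots> < i (k + 1) = n\<close>; extensionality makes each chain
  correspond to exactly one function.\<close>

definition index_chains :: "nat \<Rightarrow> nat \<Rightarrow> (nat \<Rightarrow> nat) set" where
  "index_chains n k = {i \<in> {1..k+1} \<rightarrow>\<^sub>E {1..n}.
     i 1 = 1 \<and> i (k + 1) = n \<and> (\<forall>j\<in>{1..k}. i j < i (j + 1))}"

end

theory Submission
  imports Defs
begin

text \<open>Cutting a permutation at its first invariant initial segment gives
  \<open>n! = (\<Sum>m=1..n. \<kappa>\<^sub>m (n - m)!)\<close>. Comparing this with \<open>n\<close> times the same identity
  for \<open>n - 1\<close> yields the positive recurrence \<open>\<kappa>\<^sub>n = (\<Sum>m=1..n-1. (n - m - 1)! m \<kappa>\<^sub>m)\<close>,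
  and iterating it down to \<open>\<kappa>\<^sub>1 = 1\<close> produces the sum over chains.\<close>

section \<open>Permutations sorted by their first invariant initial segment\<close>

definition first_block :: "(nat \<Rightarrow> nat) \<Rightarrow> nat \<Rightarrow> bool" where
  "first_block \<pi> m \<longleftrightarrow>
     1 \<le> m \<and> \<pi> ` {1..m} = {1..m} \<and> (\<forall>l. 1 \<le> l \<and> l < m \<longrightarrow> \<pi> ` {1..l} \<noteq> {1..l})"

lemma first_block_unique: "first_block \<pi> l \<Longrightarrow> first_block \<pi> m \<Longrightarrow> l = m"
  unfolding first_block_def by (meson linorder_neqE_nat)

lemma first_block_exists:
  assumes "\<pi> permutes {1..n}" "1 \<le> n"
  shows "\<exists>m\<in>{1..n}. first_block \<pi> m"
proof -
  let ?P = "\<lambda>m. 1 \<le> m \<and> \<pi> ` {1..m} = {1..m}"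
  have n: "?P n"
    using assms by (simp add: permutes_image)
  then have "?P (LEAST m. ?P m)" "(LEAST m. ?P m) \<le> n"
    by (rule LeastI, intro Least_le)
  moreover have "\<not> ?P l" if "l < (LEAST m. ?P m)" for l
    using that by (rule not_less_Least)
  ultimately show ?thesis
    unfolding first_block_def by (intro bexI[of _ "LEAST m. ?P m"]) auto
qed

text \<open>Such a permutation factors uniquely as \<sigma> \<circ> \<tau>, with \<sigma> connected
  on \<open>{1..m}\<close> and \<tau> an arbitrary permutation of \<open>{m+1..n}\<close>. The
  supports are disjoint, so \<open>?f\<close> and \<open>?g\<close> recover the factors by cutting
  at m.\<close>

lemma card_first_block:
  assumes "1 \<le> m" "m \<le> n"
  shows "card {\<pi>. \<pi> permutes {1..n} \<and> first_block \<pi> m} = kappa m * fact (n - m)"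
proof -
  let ?A = "{\<sigma>. connected_perm m \<sigma>}" and ?B = "{\<tau>. \<tau> permutes {m+1..n}}"
  let ?f = "\<lambda>\<pi> x. if x \<in> {1..m} then \<pi> x else x" and ?g = "\<lambda>\<pi> x. if x \<in> {1..m} then x else \<pi> x"
  have fix_low: "\<tau> x = x" if "\<tau> permutes {m+1..n}" "x \<in> {1..m}" for \<tau> :: "nat \<Rightarrow> nat" and x
    using permutes_not_in[OF that(1)] that(2) by auto
  have high: "\<sigma> (\<tau> x) = \<tau> x" if "\<sigma> permutes {1..m}" "\<tau> permutes {m+1..n}" "x \<notin> {1..m}" for \<sigma> \<tau> x
  proof -
    \<comment> \<open>Otherwise \<tau> would fix \<tau> x, and injectivity would give \<tau> x = x,
      which lies outside \<open>{1..m}\<close>.\<close>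
    have "\<tau> x \<notin> {1..m}"
      using fix_low[OF that(2)] permutes_inj[OF that(2)] that(3) by (metis injD)
    then show ?thesis
      using permutes_not_in[OF that(1)] by blast
  qed
  have "bij_betw (\<lambda>(\<sigma>, \<tau>). \<sigma> \<circ> \<tau>) (?A \<times> ?B) {\<pi>. \<pi> permutes {1..n} \<and> first_block \<pi> m}"
  proof (rule bij_betw_byWitness[where f' = "\<lambda>\<pi>. (?f \<pi>, ?g \<pi>)"])
    show "\<forall>p\<in>?A \<times> ?B. (\<lambda>\<pi>. (?f \<pi>, ?g \<pi>)) ((\<lambda>(\<sigma>, \<tau>). \<sigma> \<circ> \<tau>) p) = p"
    proof
      fix p assume "p \<in> ?A \<times> ?B"
      then obtain \<sigma> \<tau> where p: "p = (\<sigma>, \<tau>)" and \<sigma>: "\<sigma> permutes {1..m}" and \<tau>: "\<tau> permutes {m+1..n}"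
        by (auto simp: connected_perm_def)
      have "?f (\<sigma> \<circ> \<tau>) = \<sigma>"
        using fix_low[OF \<tau>] permutes_not_in[OF \<sigma>] by (intro ext) auto
      moreover have "?g (\<sigma> \<circ> \<tau>) = \<tau>"
        using fix_low[OF \<tau>] high[OF \<sigma> \<tau>] by (intro ext) auto
      ultimately show "(\<lambda>\<pi>. (?f \<pi>, ?g \<pi>)) ((\<lambda>(\<sigma>, \<tau>). \<sigma> \<circ> \<tau>) p) = p"
        unfolding p by (simp only: prod.case)
    qed
    show "\<forall>\<pi>\<in>{\<pi>. \<pi> permutes {1..n} \<and> first_block \<pi> m}. (\<lambda>(\<sigma>, \<tau>). \<sigma> \<circ> \<tau>) (?f \<pi>, ?g \<pi>) = \<pi>"
    proof
      fix \<pi> assume "\<pi> \<in> {\<pi>. \<pi> permutes {1..n} \<and> first_block \<pi> m}"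
      then have \<pi>: "\<pi> permutes {1..n}" and im: "\<pi> ` {1..m} = {1..m}"
        by (auto simp: first_block_def)
      \<comment> \<open>Injectivity keeps outside points outside, so the factor
        \<open>?f \<pi>\<close> leaves alone what \<open>?g \<pi>\<close> produces there.\<close>
      have "\<pi> x \<notin> {1..m}" if "x \<notin> {1..m}" for x
        using im permutes_inj[OF \<pi>] that by (metis inj_image_mem_iff)
      then show "(\<lambda>(\<sigma>, \<tau>). \<sigma> \<circ> \<tau>) (?f \<pi>, ?g \<pi>) = \<pi>"
        by (auto simp: fun_eq_iff)
    qed
    show "(\<lambda>(\<sigma>, \<tau>). \<sigma> \<circ> \<tau>) ` (?A \<times> ?B) \<subseteq> {\<pi>. \<pi> permutes {1..n} \<and> first_block \<pi> m}"
    proof clarify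
      fix \<sigma> \<tau> :: "nat \<Rightarrow> nat"
      assume conn: "connected_perm m \<sigma>" and \<tau>: "\<tau> permutes {m+1..n}"
      then have \<sigma>: "\<sigma> permutes {1..m}"
        by (auto simp: connected_perm_def)
      have "\<sigma> permutes {1..n}" "\<tau> permutes {1..n}"
        using permutes_subset[OF \<sigma>] permutes_subset[OF \<tau>] assms by auto
      then have "\<sigma> \<circ> \<tau> permutes {1..n}"
        by (rule permutes_compose[rotated])
      \<comment> \<open>Up to m the images of initial segments depend on \<sigma> alone, so
        connectedness of \<sigma> is exactly minimality of the block m.\<close>
      moreover have "(\<sigma> \<circ> \<tau>) ` {1..l} = \<sigma> ` {1..l}" if "l \<le> m" for l
        using fix_low[OF \<tau>] that by (intro image_cong) auto
      ultimately show "\<sigma> \<circ> \<tau> permutes {1..n} \<and> first_block (\<sigma> \<circ> \<tau>) m"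
        using conn assms(1) permutes_image[OF \<sigma>]
        unfolding first_block_def connected_perm_def by auto
    qed
    show "(\<lambda>\<pi>. (?f \<pi>, ?g \<pi>)) ` {\<pi>. \<pi> permutes {1..n} \<and> first_block \<pi> m} \<subseteq> ?A \<times> ?B"
    proof
      fix p assume "p \<in> (\<lambda>\<pi>. (?f \<pi>, ?g \<pi>)) ` {\<pi>. \<pi> permutes {1..n} \<and> first_block \<pi> m}"
      then obtain \<pi> where p: "p = (?f \<pi>, ?g \<pi>)" and \<pi>: "\<pi> permutes {1..n}" and fb: "first_block \<pi> m"
        by blast
      have im: "\<pi> ` {1..m} = {1..m}"
        using fb by (auto simp: first_block_def)
      have inj: "inj \<pi>"
        using \<pi> by (rule permutes_inj)
      have "?f \<pi> permutes {1..m}"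
      proof (rule bij_imp_permutes)
        show "bij_betw (?f \<pi>) {1..m} {1..m}"
          using im inj_on_subset[OF inj] by (auto simp: bij_betw_def inj_on_def)
      qed auto
      moreover have "\<not> (\<exists>l. 1 \<le> l \<and> l < m \<and> ?f \<pi> ` {1..l} = {1..l})"
      proof (intro notI, elim exE conjE)
        fix l assume l: "1 \<le> l" "l < m" and "?f \<pi> ` {1..l} = {1..l}"
        moreover have "?f \<pi> ` {1..l} = \<pi> ` {1..l}"
          using l by (intro image_cong) auto
        ultimately have "\<pi> ` {1..l} = {1..l}"
          by (simp only:)
        then show False
          using fb l by (auto simp: first_block_def)
      qed
      ultimately have "connected_perm m (?f \<pi>)"
        unfolding connected_perm_def by (rule conjI)
      moreover have "?g \<pi> permutes {m+1..n}"
      proof (rule bij_imp_permutes)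
        \<comment> \<open>An injective map preserves set differences, so the complement of the
          invariant block is invariant too.\<close>
        have "{m+1..n} = {1..n} - {1..m}"
          using assms by auto
        then have "\<pi> ` {m+1..n} = {m+1..n}"
          using im permutes_image[OF \<pi>] image_set_diff[OF inj] by metis
        moreover have "?g \<pi> ` {m+1..n} = \<pi> ` {m+1..n}"
          by (intro image_cong) auto
        moreover have "inj_on (?g \<pi>) {m+1..n}"
          using inj by (auto simp: inj_on_def)
        ultimately show "bij_betw (?g \<pi>) {m+1..n} {m+1..n}"
          by (simp add: bij_betw_def)
        show "?g \<pi> x = x" if "x \<notin> {m+1..n}" for x
          using that permutes_not_in[OF \<pi>, of x] by auto
      qed
      ultimately show "p \<in> ?A \<times> ?B"
        unfolding p by blast
    qed
  qed
  then have "card {\<pi>. \<pi> permutes {1..n} \<and> first_block \<pi> m} = card (?A \<times> ?B)"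
    by (rule bij_betw_same_card[symmetric])
  also have "\<dots> = kappa m * fact (n - m)"
    using card_permutations[of "{m+1..n}" "n - m"] by (simp add: card_cartesian_product kappa_def)
  finally show ?thesis .
qed

lemma fact_eq_sum_kappa:
  assumes "1 \<le> n"
  shows "fact n = (\<Sum>m=1..n. kappa m * fact (n - m))"
proof -
  let ?S = "\<lambda>m. {\<pi>. \<pi> permutes {1..n} \<and> first_block \<pi> m}"
  have "{\<pi>. \<pi> permutes {1..n}} = (\<Union>m\<in>{1..n}. ?S m)"
    using first_block_exists[OF _ assms] by blast
  moreover have "card {\<pi>. \<pi> permutes {1..n}} = fact n"
    by (rule card_permutations) auto
  ultimately have "fact n = card (\<Union>m\<in>{1..n}. ?S m)"
    by simp
  also have "\<dots> = (\<Sum>m=1..n. card (?S m))"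
  proof (rule card_UN_disjoint)
    show "\<forall>m\<in>{1..n}. finite (?S m)"
      using finite_permutations[of "{1..n}"] by auto
    show "\<forall>l\<in>{1..n}. \<forall>m\<in>{1..n}. l \<noteq> m \<longrightarrow> ?S l \<inter> ?S m = {}"
      using first_block_unique by blast
  qed auto
  also have "\<dots> = (\<Sum>m=1..n. kappa m * fact (n - m))"
    by (intro sum.cong card_first_block) auto
  finally show ?thesis .
qed

lemma kappa_1: "kappa 1 = 1"
  using fact_eq_sum_kappa[of 1] by simp

section \<open>The positive recurrence\<close>

lemma kappa_recurrence:
  assumes "2 \<le> n"
  shows "kappa n = (\<Sum>m=1..n-1. kappa m * (fact (n - m - 1) * m))"
proof -
  \<comment> \<open>The term m = n is split off; its factorial is 0! = 1.\<close>
  have "(\<Sum>m=1..n-1. kappa m * fact (n - m)) + kappa n = fact n"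
  proof -
    obtain k where "n = Suc k"
      using assms by (cases n) auto
    then show ?thesis
      using fact_eq_sum_kappa[of n] by simp
  qed
  also have "fact n = n * fact (n - 1)"
    using assms by (simp add: fact_reduce)
  also have "\<dots> = (\<Sum>m=1..n-1. kappa m * (n * fact (n - 1 - m)))"
    using assms by (subst fact_eq_sum_kappa) (auto simp: sum_distrib_left mult_ac)
  \<comment> \<open>Writing n = (n - m) + m turns n (n - m - 1)! into (n - m)! + m (n - m - 1)!. The
    first summands cancel against the sum on the left, and no subtraction remains.\<close>
  also have "\<dots> = (\<Sum>m=1..n-1. kappa m * fact (n - m) + kappa m * (fact (n - m - 1) * m))"
  proof (rule sum.cong)
    fix m assume "m \<in> {1..n-1}"
    \<comment> \<open>Putting n = m + d + 1 removes the truncated subtractions.\<close>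
    then have "n = Suc (m + (n - m - 1))"
      by auto
    then obtain d where "n = Suc (m + d)" ..
    then show "kappa m * (n * fact (n - 1 - m)) =
        kappa m * fact (n - m) + kappa m * (fact (n - m - 1) * m)"
      by (simp add: Suc_diff_le algebra_simps)
  qed simp
  finally show ?thesis
    by (simp add: sum.distrib)
qed

section \<open>Recursion for the sums over chains\<close>

definition chain_sum :: "nat \<Rightarrow> nat \<Rightarrow> nat" where
  "chain_sum n k = (\<Sum>i\<in>index_chains n k. \<Prod>j=1..k. fact (i (j + 1) - i j - 1) * i j)"

lemma finite_index_chains: "finite (index_chains n k)"
  unfolding index_chains_def by (rule finite_subset[of _ "{1..k+1} \<rightarrow>\<^sub>E {1..n}"]) (auto intro: finite_PiE)

text \<open>Base case: a chain with a single entry forces 1 = n, extensionality leaves one such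
  function, and the empty product is 1.\<close>

lemma chain_sum_0: "chain_sum n 0 = (if n = 1 then 1 else 0)"
proof -
  have "index_chains n 0 = (if n = 1 then {\<lambda>x\<in>{1}. 1} else {})"
    unfolding index_chains_def by (auto simp: PiE_iff extensional_def fun_eq_iff)
  then show ?thesis
    by (simp add: chain_sum_def)
qed

text \<open>Needed to bound every entry of a shortened chain by its new last entry, as the codomain
  in \<open>index_chains\<close> demands.\<close>

lemma index_chain_mono:
  assumes "i \<in> index_chains n k" "1 \<le> a" "a \<le> b" "b \<le> k + 1"
  shows "i a \<le> i b"
  using assms(3,4)
proof (induction b rule: dec_induct)
  case (step b)
  then have "i b < i (b + 1)"
    using assms(1,2) unfolding index_chains_def by auto
  with step show ?case
    by simp
qed simp

text \<open>Dropping the endpoint n makes the penultimate entry the new endpoint.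
  \<open>restrict\<close> resets the freed position k + 2 to \<open>undefined\<close>, so the result
  is again extensional.\<close>

lemma index_chain_init:
  assumes "i \<in> index_chains n (Suc k)"
  shows "i (k + 1) \<in> {1..n-1}" "restrict i {1..k+1} \<in> index_chains (i (k + 1)) k"
proof -
  have "i (k + 1) < i (Suc k + 1)" "i (Suc k + 1) = n" "i (k + 1) \<in> {1..n}"
    using assms unfolding index_chains_def by (auto simp: PiE_iff)
  then show "i (k + 1) \<in> {1..n-1}"
    by auto
  have "i j \<in> {1..i (k + 1)}" if "j \<in> {1..k+1}" for j
    using that index_chain_mono[OF assms, of j "k + 1"] assms
    unfolding index_chains_def by (auto simp: PiE_iff)
  then show "restrict i {1..k+1} \<in> index_chains (i (k + 1)) k"
    using assms unfolding index_chains_def by auto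
qed

lemma index_chain_extend:
  assumes "c \<in> index_chains m k" "m \<in> {1..n-1}"
  shows "c(k + 2 := n) \<in> index_chains n (Suc k)"
proof -
  have c: "c \<in> {1..k+1} \<rightarrow>\<^sub>E {1..m}" "c 1 = 1" "c (k + 1) = m" "\<And>j. j \<in> {1..k} \<Longrightarrow> c j < c (j + 1)"
    using assms(1) unfolding index_chains_def by auto
  have "c(k + 2 := n) \<in> {1..Suc k+1} \<rightarrow>\<^sub>E {1..n}"
  proof (rule PiE_I)
    fix j assume "j \<in> {1..Suc k+1}"
    then consider "j = k + 2" | "j \<in> {1..k+1}" "j \<noteq> k + 2"
      by force
    then show "(c(k + 2 := n)) j \<in> {1..n}"
    proof cases
      case 2
      then have "c j \<in> {1..m}"
        using c(1) by blast
      with 2 assms(2) show ?thesis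
        by auto
    qed (use assms(2) in auto)
  next
    fix j assume "j \<notin> {1..Suc k+1}"
    then show "(c(k + 2 := n)) j = undefined"
      using PiE_arb[OF c(1)] by auto
  qed
  moreover have "(c(k + 2 := n)) j < (c(k + 2 := n)) (j + 1)" if "j \<in> {1..Suc k}" for j
    using that c(3) c(4)[of j] assms(2) by (cases "j = Suc k") auto
  ultimately show ?thesis
    unfolding index_chains_def using c(2) by auto
qed

text \<open>Chains are grouped by their penultimate entry m. The last factor, j = k + 1, is (n - m -
  1)! m, and the other factors form the weight of the shortened chain ending in m. Dropping and
  appending n are mutually inverse.\<close>

lemma chain_sum_Suc:
  "chain_sum n (Suc k) = (\<Sum>m=1..n-1. chain_sum m k * (fact (n - m - 1) * m))"
proof -
  let ?w = "\<lambda>i j. fact (i (j + 1) - i j - 1) * i j :: nat"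
  have "chain_sum n (Suc k) =
      (\<Sum>(m, c)\<in>Sigma {1..n-1} (\<lambda>m. index_chains m k). (\<Prod>j=1..k. ?w c j) * (fact (n - m - 1) * m))"
    unfolding chain_sum_def
  proof (rule sum.reindex_bij_witness[where
        j = "\<lambda>i. (i (k + 1), restrict i {1..k+1})" and i = "\<lambda>(m, c). c(k + 2 := n)"])
    fix i assume i: "i \<in> index_chains n (Suc k)"
    show "(i (k + 1), restrict i {1..k+1}) \<in> Sigma {1..n-1} (\<lambda>m. index_chains m k)"
      using index_chain_init[OF i] by blast
    have n: "i (k + 2) = n" and ext: "i \<in> extensional {1..k+2}"
      using i unfolding index_chains_def by (auto simp: PiE_def)
    then show "(case (i (k + 1), restrict i {1..k+1}) of (m, c) \<Rightarrow> c(k + 2 := n)) = i"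
      by (auto simp: fun_eq_iff extensional_def)
    show "(case (i (k + 1), restrict i {1..k+1}) of
        (m, c) \<Rightarrow> (\<Prod>j=1..k. ?w c j) * (fact (n - m - 1) * m)) = (\<Prod>j=1..Suc k. ?w i j)"
      using n by simp
  next
    fix p assume p: "p \<in> Sigma {1..n-1} (\<lambda>m. index_chains m k)"
    then obtain m c where mc: "p = (m, c)" "m \<in> {1..n-1}" "c \<in> index_chains m k"
      by blast
    then show "(case p of (m, c) \<Rightarrow> c(k + 2 := n)) \<in> index_chains n (Suc k)"
      using index_chain_extend by simp
    have "c (k + 1) = m" "c \<in> extensional {1..k+1}"
      using mc(3) unfolding index_chains_def by (auto simp: PiE_def)
    then show "(((case p of (m, c) \<Rightarrow> c(k + 2 := n)) (k + 1)),
        restrict (case p of (m, c) \<Rightarrow> c(k + 2 := n)) {1..k+1}) = p"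
      unfolding mc(1) by (auto simp: fun_eq_iff extensional_def)
  qed
  also have "\<dots> = (\<Sum>m=1..n-1. \<Sum>c\<in>index_chains m k. (\<Prod>j=1..k. ?w c j) * (fact (n - m - 1) * m))"
    by (rule sum.Sigma[symmetric]) (auto simp: finite_index_chains)
  finally show ?thesis
    by (simp only: chain_sum_def sum_distrib_right)
qed

text \<open>Chains ending in n have at most n entries, so every cutoff K \<ge> n gives the same sum.
  This freedom is what the induction needs: one cutoff L = K - 1 must serve all m < n at
  once.\<close>

lemma sum_chain_sum_eq_kappa: "1 \<le> n \<Longrightarrow> n \<le> K \<Longrightarrow> (\<Sum>k<K. chain_sum n k) = kappa n"
proof (induction n arbitrary: K rule: less_induct)
  case (less n)
  then obtain L where K: "K = Suc L"
    by (cases K) auto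
  \<comment> \<open>Separating k = 0 and shifting the rest lets \<open>chain_sum_Suc\<close> apply
    to each term; the sums over k and m are then exchanged.\<close>
  have split: "(\<Sum>k<K. chain_sum n k) =
      chain_sum n 0 + (\<Sum>m=1..n-1. (\<Sum>k<L. chain_sum m k) * (fact (n - m - 1) * m))"
    unfolding K sum.lessThan_Suc_shift chain_sum_Suc sum_distrib_right by (subst sum.swap) (rule refl)
  show ?case
  proof (cases "n = 1")
    case True
    then show ?thesis
      using split by (simp add: chain_sum_0 kappa_1[simplified])
  next
    case False
    \<comment> \<open>Each m \<le> n - 1 satisfies m \<le> L, so the induction hypothesis turns
      every inner sum into \<open>kappa m\<close>, leaving the recurrence.\<close>
    have "(\<Sum>m=1..n-1. (\<Sum>k<L. chain_sum m k) * (fact (n - m - 1) * m)) = kappa n"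
      using False less.prems K
      by (subst kappa_recurrence) (auto intro!: sum.cong simp: less.IH)
    then show ?thesis
      using split False by (simp add: chain_sum_0)
  qed
qed

theorem theorem4p7:
  fixes n :: nat
  assumes "n \<ge> 2"
  shows "kappa n = (\<Sum>k=1..n-1. \<Sum>i\<in>index_chains n k. \<Prod>j=1..k. fact (i (j + 1) - i j - 1) * i j)"
proof -
  \<comment> \<open>With cutoff K = n the only surplus term is k = 0, which vanishes because n
    \<noteq> 1.\<close>
  have "{..<n} = insert 0 {1..n-1}"
    using assms by auto
  then have "kappa n = (\<Sum>k=1..n-1. chain_sum n k)"
    using sum_chain_sum_eq_kappa[of n n] assms by (simp add: chain_sum_0)
  then show ?thesis
    by (simp only: chain_sum_def)
qed

end
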